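(* Let $M,N$ be positive integers and $x_1,\dots,x_N\in\mathbb C$. Then $\tau=\mathbf{B}^*(x_1)\mathbf{B}^*(x_2)\cdots\mathbf{B}^*(x_N)|0\rangle\in\widetilde{\mathcal M}$ is a bosonic KP tau function, i.e. $$\mathrm{Res}_{z}\,\varphi(z)\otimes\varphi^*(z)\,(\tau\otimes\tau)=\sum_{i\in\mathbb Z}\varphi_i\tau\otimes\varphi^*_{-i}\tau=0 .$$
   Context: The charged free bosons $\varphi_i,\varphi^*_i$ ($i\in\mathbb Z$) satisfy $[\varphi_i,\varphi^*_j]=\delta_{i,-j}$, $[\varphi_i,\varphi_j]=[\varphi^*_i,\varphi^*_j]=0$; $\varphi(z)=\sum_i\varphi_iz^{-i-1}$, $\varphi^*(z)=\sum_i\varphi^*_iz^{-i}$, and $\mathrm{Res}_z$ is the coefficient of $z^{-1}$. The complex Fock space $\mathcal M$ is generated by $|0\rangle$ with $\varphi_i|0\rangle=\varphi^*_{i+1}|0\rangle=0$ for $i\ge0$; it has a basis of monomials in $\varphi_{-m}$ ($m\ge1$) and $\varphi^*_{-k}$ ($k\ge0$) applied to $|0\rangle$. $\widetilde{\mathcal M}$ is its completion by gradation, i.e. the space of formal infinite linear combinations of these basis monomials. For a fixed positive integer $M$, $$\mathbf B^*(x)=\exp(x\varphi_{-M}\varphi^*_{M-1})\exp(x\varphi_{-M+1}\varphi^*_{M-2})\cdots,$$ i.e. the ordered product of $\exp(x\varphi_{-i}\varphi^*_{i-1})$ over $i\le M$, $i$ decreasing from left to right; for each fixed vector of $\mathcal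 M$ only finitely many terms contribute to each degree (where $\deg\varphi_{-m}=\deg\varphi_{-m}^*=m$). The sum over $i$ in the claim is taken in the correspondingly completed tensor square. *)

theory Defs
  imports Complex_Main "HOL-Library.Multiset" "HOL-Library.Groups_Big_Fun"
begin

section \<open>The Fock space of charged free bosons\<close>

text \<open>
  Creation modes, indexed by natural numbers so that every value is a creation operator:
  \<open>Phi k\<close> stands for \<open>\<phi>\<^bsub>-(k+1)\<^esub>\<close> and \<open>PhiStar k\<close> for \<open>\<phi>\<^sup>*\<^bsub>-k\<^esub>\<close>.
  Creation modes commute, so a basis monomial applied to the vacuum is a multiset of modes. An
  element of the completed Fock space is a formal infinite linear combination of basis monomials,
  i.e. an arbitrary coefficient function.
\<close>

datatype mode = Phi nat | PhiStar nat

type_synonym fock = "mode multiset \<Rightarrow> complex"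

definition basis :: "mode multiset \<Rightarrow> fock" where
  "basis n = (\<lambda>m. if m = n then 1 else 0)"

definition vacuum :: fock where
  "vacuum = basis {#}"

text \<open>Multiplication by a mode and the partial derivative with respect to it, on coefficients.\<close>

definition create :: "mode \<Rightarrow> fock \<Rightarrow> fock" where
  "create g v = (\<lambda>m. if g \<in># m then v (m - {#g#}) else 0)"

definition annihilate :: "mode \<Rightarrow> fock \<Rightarrow> fock" where
  "annihilate g v = (\<lambda>m. of_nat (count m g + 1) * v (add_mset g m))"

definition phi :: "int \<Rightarrow> fock \<Rightarrow> fock" where
  "phi i v = (if i < 0 then create (Phi (nat (- i - 1))) v else annihilate (PhiStar (nat i)) v)"

text \<open>The sign comes from \<open>[\<phi>\<^sub>i, \<phi>\<^sup>*\<^sub>j] = \<delta>\<^bsub>i,-j\<^esub>\<close> with \<open>i < 0\<close>.\<close>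

definition phi_star :: "int \<Rightarrow> fock \<Rightarrow> fock" where
  "phi_star i v =
     (if i \<le> 0 then create (PhiStar (nat (- i))) v else (\<lambda>m. - annihilate (Phi (nat (i - 1))) v m))"

lemma create_commute: "create g (create h v) = create h (create g v)"
proof (cases "g = h")
  case False
  then show ?thesis
    by (intro ext) (simp add: create_def in_diff_count diff_diff_add_mset add_mset_commute)
qed simp

lemma annihilate_commute: "annihilate g (annihilate h v) = annihilate h (annihilate g v)"
  by (rule ext) (auto simp: annihilate_def add_mset_commute)

lemma annihilate_create_other:
  assumes "g \<noteq> h"
  shows "annihilate g (create h v) m = create h (annihilate g v) m"
proof (cases "h \<in># m")
  case True
  then obtain n where "m = add_mset h n" by (auto dest: multi_member_split)
  moreover have "add_mset g (add_mset h n) - {#h#} = add_mset g n"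
    by (simp add: add_mset_commute[of g h])
  ultimately show ?thesis using assms by (simp add: annihilate_def create_def)
next
  case False
  then show ?thesis using assms by (simp add: annihilate_def create_def)
qed

lemma annihilate_create_same: "annihilate g (create g v) m = create g (annihilate g v) m + v m"
proof (cases "g \<in># m")
  case True
  then obtain n where "m = add_mset g n" by (auto dest: multi_member_split)
  then show ?thesis by (simp add: annihilate_def create_def algebra_simps)
next
  case False
  then have "count m g = 0" by (simp add: not_in_iff)
  with False show ?thesis by (simp add: annihilate_def create_def)
qed

lemma create_neg: "create g (\<lambda>m. - v m) m = - create g v m"
  by (simp add: create_def)

lemma annihilate_neg: "annihilate g (\<lambda>m. - v m) m = - annihilate g v m"
  by (simp add: annihilate_def)

lemma phi_phi_star_commutator:
  "phi i (phi_star j v) m - phi_star j (phi i v) m = (if i = - j then v m else 0)"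
proof -
  have *: "create g (create h v) m = create h (create g v) m"
          "annihilate g (annihilate h v) m = annihilate h (annihilate g v) m" for g h
    by (simp_all add: create_commute[of g h] annihilate_commute[of g h])
  show ?thesis
  proof (cases "i < 0")
    case i: True
    show ?thesis
    proof (cases "j \<le> 0")
      case True
      then show ?thesis using i by (simp add: phi_def phi_star_def create_commute)
    next
      case False
      show ?thesis
      proof (cases "i = - j")
        case True
        then show ?thesis using i False
          by (simp add: phi_def phi_star_def create_neg annihilate_create_same)
      next
        case n: False
        then have "nat (j - 1) \<noteq> nat (- i - 1)" using i False by linarith
        then show ?thesis using i False n
          by (simp add: phi_def phi_star_def create_neg annihilate_create_other)
      qed
    qed
  next
    case i: False
    show ?thesis
    proof (cases "j \<le> 0")
      case True
      show ?thesis
      proof (cases "i = - j")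
        case True
        then show ?thesis using i \<open>j \<le> 0\<close>
          by (simp add: phi_def phi_star_def annihilate_create_same)
      next
        case n: False
        then have "nat i \<noteq> nat (- j)" using i True by linarith
        then show ?thesis using i True n
          by (simp add: phi_def phi_star_def annihilate_create_other)
      qed
    next
      case False
      then show ?thesis using i *(2) by (simp add: phi_def phi_star_def annihilate_neg)
    qed
  qed
qed

lemma phi_phi_commute: "phi i (phi j v) = phi j (phi i v)"
proof -
  have "create g (create h v) = create h (create g v)"
       "annihilate g (annihilate h v) = annihilate h (annihilate g v)" for g h
    by (rule create_commute annihilate_commute)+
  moreover have "annihilate (PhiStar k) (create (Phi l) v) = create (Phi l) (annihilate (PhiStar k) v)" for k l
    by (rule ext) (simp add: annihilate_create_other)
  ultimately show ?thesis by (simp add: phi_def)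
qed

lemma phi_star_phi_star_commute: "phi_star i (phi_star j v) = phi_star j (phi_star i v)"
proof -
  have "create g (create h v) = create h (create g v)"
       "annihilate g (annihilate h v) = annihilate h (annihilate g v)" for g h
    by (rule create_commute annihilate_commute)+
  moreover have "annihilate (Phi k) (create (PhiStar l) v) = create (PhiStar l) (annihilate (Phi k) v)" for k l
    by (rule ext) (simp add: annihilate_create_other)
  moreover have "create g (\<lambda>m. - w m) = (\<lambda>m. - create g w m)"
       "annihilate g (\<lambda>m. - w m) = (\<lambda>m. - annihilate g w m)" for g w
    by (auto simp: create_neg annihilate_neg)
  ultimately show ?thesis by (simp add: phi_star_def)
qed

lemma phi_vacuum: "i \<ge> 0 \<Longrightarrow> phi i vacuum = (\<lambda>_. 0)"
  by (auto simp: phi_def annihilate_def vacuum_def basis_def)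

lemma phi_star_vacuum: "i \<ge> 0 \<Longrightarrow> phi_star (i + 1) vacuum = (\<lambda>_. 0)"
  by (auto simp: phi_star_def annihilate_def vacuum_def basis_def)

lemma create_basis: "create g (basis n) = basis (add_mset g n)"
  by (rule ext) (auto simp: create_def basis_def dest!: multi_member_split)

lemma phi_basis: "phi (- int k - 1) (basis n) = basis (add_mset (Phi k) n)"
  by (simp add: phi_def create_basis)

lemma phi_star_basis: "phi_star (- int k) (basis n) = basis (add_mset (PhiStar k) n)"
  by (simp add: phi_star_def create_basis)


section \<open>Formal infinite sums and the completed tensor square\<close>

text \<open>A family may be summed formally iff each coefficient receives finitely many contributions.\<close>

definition locally_finite :: "('i \<Rightarrow> 'b \<Rightarrow> complex) \<Rightarrow> bool" where
  "locally_finite F \<longleftrightarrow> (\<forall>b. finite {i. F i b \<noteq> 0})"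

definition formal_sum :: "('i \<Rightarrow> 'b \<Rightarrow> complex) \<Rightarrow> 'b \<Rightarrow> complex" where
  "formal_sum F = (\<lambda>b. Sum_any (\<lambda>i. F i b))"

text \<open>
  The modes act on the completion by the coefficientwise extension of their action on monomials.
\<close>

lemma formal_sum_single:
  fixes v :: fock
  assumes "\<And>n. n \<noteq> k m \<Longrightarrow> F n m = 0"
  shows "formal_sum (\<lambda>n m. v n * F n m) m = v (k m) * F (k m) m"
proof -
  have "Sum_any (\<lambda>n. v n * F n m) = (\<Sum>n\<in>{k m}. v n * F n m)"
    by (rule Sum_any.expand_superset) (use assms in auto)
  then show ?thesis by (simp add: formal_sum_def)
qed

lemma create_extends: "create g v = formal_sum (\<lambda>n m. v n * create g (basis n) m)"
proof
  fix m
  show "create g v m = formal_sum (\<lambda>n m. v n * create g (basis n) m) m"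
    by (subst formal_sum_single[where k = "\<lambda>m. m - {#g#}"]) (auto simp: create_def basis_def)
qed

lemma annihilate_extends: "annihilate g v = formal_sum (\<lambda>n m. v n * annihilate g (basis n) m)"
proof
  fix m
  show "annihilate g v m = formal_sum (\<lambda>n m. v n * annihilate g (basis n) m) m"
    by (subst formal_sum_single[where k = "add_mset g"]) (auto simp: annihilate_def basis_def)
qed

definition tensor :: "fock \<Rightarrow> fock \<Rightarrow> (mode multiset \<times> mode multiset \<Rightarrow> complex)" where
  "tensor u v = (\<lambda>(m, n). u m * v n)"

lemma locally_finite_KP: "locally_finite (\<lambda>i::int. tensor (phi i u) (phi_star (- i) v))"
  unfolding locally_finite_def
proof
  fix b :: "mode multiset \<times> mode multiset"
  obtain m n where b: "b = (m, n)" by (cases b)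
  have "{i. tensor (phi i u) (phi_star (- i) v) b \<noteq> 0} \<subseteq>
     (\<lambda>g. case g of Phi k \<Rightarrow> - int k - 1 | PhiStar k \<Rightarrow> int k) ` (set_mset m \<union> set_mset n)"
  proof
    fix i assume "i \<in> {i. tensor (phi i u) (phi_star (- i) v) b \<noteq> 0}"
    then have nz: "phi i u m \<noteq> 0" "phi_star (- i) v n \<noteq> 0" by (auto simp: b tensor_def)
    show "i \<in> (\<lambda>g. case g of Phi k \<Rightarrow> - int k - 1 | PhiStar k \<Rightarrow> int k) ` (set_mset m \<union> set_mset n)"
    proof (cases "i < 0")
      case True
      then have "Phi (nat (- i - 1)) \<in># m" using nz by (auto simp: phi_def create_def split: if_splits)
      then show ?thesis using True by (intro image_eqI[of _ _ "Phi (nat (- i - 1))"]) auto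
    next
      case False
      then have "PhiStar (nat i) \<in># n" using nz by (auto simp: phi_star_def create_def split: if_splits)
      then show ?thesis using False by (intro image_eqI[of _ _ "PhiStar (nat i)"]) auto
    qed
  qed
  then show "finite {i. tensor (phi i u) (phi_star (- i) v) b \<noteq> 0}"
    by (rule finite_subset) auto
qed


section \<open>The bosonic KP equation\<close>

text \<open>
  A formal distribution in \<open>z\<close> is the function sending \<open>k\<close> to its coefficient of \<open>z\<^sup>k\<close>; the two
  fields below are \<open>\<phi>(z)v\<close> and \<open>\<phi>\<^sup>*(z)v\<close>.
\<close>

definition phi_field :: "fock \<Rightarrow> int \<Rightarrow> fock" where
  "phi_field v = (\<lambda>k. phi (- k - 1) v)"

definition phi_star_field :: "fock \<Rightarrow> int \<Rightarrow> fock" where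
  "phi_star_field v = (\<lambda>k. phi_star (- k) v)"

definition tensor_field ::
    "(int \<Rightarrow> fock) \<Rightarrow> (int \<Rightarrow> fock) \<Rightarrow> int \<Rightarrow> (mode multiset \<times> mode multiset \<Rightarrow> complex)" where
  "tensor_field F G = (\<lambda>n. formal_sum (\<lambda>k. tensor (F k) (G (n - k))))"

definition Res :: "(int \<Rightarrow> 'a) \<Rightarrow> 'a" where
  "Res F = F (- 1)"


section \<open>The operators \<open>B\<^sup>*(x)\<close>\<close>

definition exp_op :: "complex \<Rightarrow> (fock \<Rightarrow> fock) \<Rightarrow> fock \<Rightarrow> fock" where
  "exp_op x A v = formal_sum (\<lambda>n m. x ^ n / fact n * (A ^^ n) v m)"

definition E_op :: "int \<Rightarrow> fock \<Rightarrow> fock" where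
  "E_op i = phi (- i) \<circ> phi_star (i - 1)"

text \<open>The product of the leftmost \<open>n\<close> factors, \<open>i = M, M - 1, \<dots>, M - n + 1\<close>.\<close>

primrec B_partial :: "nat \<Rightarrow> nat \<Rightarrow> complex \<Rightarrow> fock \<Rightarrow> fock" where
  "B_partial 0 M x = id"
| "B_partial (Suc n) M x = B_partial n M x \<circ> exp_op x (E_op (int M - int n))"

text \<open>The infinite product is the coefficientwise stable value of the partial products.\<close>

definition B_star :: "nat \<Rightarrow> complex \<Rightarrow> fock \<Rightarrow> fock" where
  "B_star M x v = (\<lambda>m. THE c. \<forall>\<^sub>F n in sequentially. B_partial n M x v m = c)"

text \<open>
  Both limiting processes are well defined on the whole completed Fock space:
  \<open>locally_finite_exp_op\<close> and \<open>B_star_stable\<close> below.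
\<close>

definition E_target :: "int \<Rightarrow> mode" where
  "E_target i = (if i > 0 then Phi (nat (i - 1)) else PhiStar (nat (1 - i)))"

lemma E_op_cases:
  obtains (dead) "E_target i \<notin># m" "\<And>v. E_op i v m = 0"
  | (live) c m' where "E_target i \<in># m" "count m' (E_target i) < count m (E_target i)"
      "\<And>v. E_op i v m = c * v m'"
      "\<And>r. \<forall>k. PhiStar k \<in># m \<longrightarrow> k \<le> r \<Longrightarrow> \<forall>k. PhiStar k \<in># m' \<longrightarrow> k \<le> r"
proof -
  consider "i > 1" | "i = 1" | "i \<le> 0" by linarith
  then show thesis
  proof cases
    case 1
    have E: "E_target i = Phi (nat (i - 1))" using 1 by (simp add: E_target_def)
    define h where "h = Phi (nat (i - 2))"
    have h: "h \<noteq> E_target i" using 1 by (auto simp: E h_def)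
    have op: "E_op i v m = create (E_target i) (\<lambda>m. - annihilate h v m) m" for v
      using 1 by (simp add: E_op_def phi_def phi_star_def E h_def)
    show thesis
    proof (cases "E_target i \<in># m")
      case False
      then show thesis by (intro dead) (auto simp: op create_def)
    next
      case True
      show thesis
      proof (rule live[of "add_mset h (m - {#E_target i#})"
            "- of_nat (count (m - {#E_target i#}) h + 1)", OF True])
        show "count (add_mset h (m - {#E_target i#})) (E_target i) < count m (E_target i)"
          using h True by auto
        show "E_op i v m = - of_nat (count (m - {#E_target i#}) h + 1) * v (add_mset h (m - {#E_target i#}))" for v
          using True unfolding op create_def annihilate_def by (simp only: if_True minus_mult_left)
        show "\<forall>k. PhiStar k \<in># add_mset h (m - {#E_target i#}) \<longrightarrow> k \<le> r"
          if "\<forall>k. PhiStar k \<in># m \<longrightarrow> k \<le> r" for r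
          using that by (auto simp: h_def dest: in_diffD)
      qed
    qed
  next
    case 2
    have E: "E_target i = Phi 0" using 2 by (simp add: E_target_def)
    have op: "E_op i v m = create (Phi 0) (create (PhiStar 0) v) m" for v
      using 2 by (simp add: E_op_def phi_def phi_star_def)
    show thesis
    proof (cases "Phi 0 \<in># m")
      case False
      then show thesis by (intro dead) (auto simp: op create_def E)
    next
      case True
      show thesis
      proof (rule live[of "m - {#Phi 0#} - {#PhiStar 0#}"
            "if PhiStar 0 \<in># m - {#Phi 0#} then 1 else 0"])
        show "E_target i \<in># m" using True E by simp
        show "count (m - {#Phi 0#} - {#PhiStar 0#}) (E_target i) < count m (E_target i)"
          using True by (auto simp: E)
        show "E_op i v m = (if PhiStar 0 \<in># m - {#Phi 0#} then 1 else 0) * v (m - {#Phi 0#} - {#PhiStar 0#})" for v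
          using True by (simp add: op create_def)
        show "\<forall>k. PhiStar k \<in># m - {#Phi 0#} - {#PhiStar 0#} \<longrightarrow> k \<le> r"
          if "\<forall>k. PhiStar k \<in># m \<longrightarrow> k \<le> r" for r
          using that by (auto dest!: in_diffD)
      qed
    qed
  next
    case 3
    define h where "h = PhiStar (nat (- i))"
    have E: "E_target i = PhiStar (Suc (nat (- i)))" using 3 by (simp add: E_target_def nat_diff_distrib' Suc_nat_eq_nat_zadd1)
    have h: "h \<noteq> E_target i" by (auto simp: E h_def)
    have "nat (1 - i) = Suc (nat (- i))" using 3 by linarith
    then have op: "E_op i v m = annihilate h (create (E_target i) v) m" for v
      using 3 by (simp add: E_op_def phi_def phi_star_def E h_def)
    show thesis
    proof (cases "E_target i \<in># m")
      case False
      then show thesis using h by (intro dead) (auto simp: op create_def annihilate_def)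
    next
      case True
      show thesis
      proof (rule live[of "add_mset h m - {#E_target i#}" "of_nat (count m h + 1)", OF True])
        show "count (add_mset h m - {#E_target i#}) (E_target i) < count m (E_target i)"
          using h True by auto
        show "E_op i v m = of_nat (count m h + 1) * v (add_mset h m - {#E_target i#})" for v
          using True h by (simp add: op create_def annihilate_def)
        show "\<forall>k. PhiStar k \<in># add_mset h m - {#E_target i#} \<longrightarrow> k \<le> r"
          if "\<forall>k. PhiStar k \<in># m \<longrightarrow> k \<le> r" for r
        proof (intro allI impI)
          fix k assume "PhiStar k \<in># add_mset h m - {#E_target i#}"
          then have "PhiStar k = h \<or> PhiStar k \<in># m" by (auto dest: in_diffD)
          moreover have "Suc (nat (- i)) \<le> r" using that True E by auto
          ultimately show "k \<le> r" using that by (auto simp: h_def)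
        qed
      qed
    qed
  qed
qed

lemma E_op_power_eq_0: "count m (E_target i) < n \<Longrightarrow> (E_op i ^^ n) v m = 0"
proof (induction n arbitrary: m)
  case (Suc n)
  show ?case
  proof (cases rule: E_op_cases[of i m])
    case (live c m')
    then have "(E_op i ^^ n) v m' = 0" using Suc by simp
    then show ?thesis by (simp add: live)
  qed simp
qed simp

lemma locally_finite_exp_op: "locally_finite (\<lambda>n m. x ^ n / fact n * (E_op i ^^ n) v m)"
  unfolding locally_finite_def
proof
  fix m
  have "{n. x ^ n / fact n * (E_op i ^^ n) v m \<noteq> 0} \<subseteq> {..count m (E_target i)}"
    using E_op_power_eq_0[of m i _ v] by (auto simp: not_less[symmetric])
  then show "finite {n. x ^ n / fact n * (E_op i ^^ n) v m \<noteq> 0}" by (rule finite_subset) simp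
qed

definition agree_upto :: "nat \<Rightarrow> fock \<Rightarrow> fock \<Rightarrow> bool" where
  "agree_upto r u v \<longleftrightarrow> (\<forall>m. (\<forall>k. PhiStar k \<in># m \<longrightarrow> k \<le> r) \<longrightarrow> u m = v m)"

lemma agree_upto_E_op: "agree_upto r u v \<Longrightarrow> agree_upto r (E_op i u) (E_op i v)"
  unfolding agree_upto_def
proof (intro allI impI)
  fix m assume *: "\<forall>m. (\<forall>k. PhiStar k \<in># m \<longrightarrow> k \<le> r) \<longrightarrow> u m = v m"
    and m: "\<forall>k. PhiStar k \<in># m \<longrightarrow> k \<le> r"
  show "E_op i u m = E_op i v m"
  proof (cases rule: E_op_cases[of i m])
    case (live c m')
    then have "u m' = v m'" using * m by blast
    then show ?thesis by (simp add: live)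
  qed simp
qed

lemma agree_upto_exp_op: "agree_upto r u v \<Longrightarrow> agree_upto r (exp_op x (E_op i) u) (exp_op x (E_op i) v)"
proof -
  assume *: "agree_upto r u v"
  have "agree_upto r ((E_op i ^^ n) u) ((E_op i ^^ n) v)" for n
    by (induction n) (auto simp: * agree_upto_E_op)
  then show ?thesis by (simp add: agree_upto_def exp_op_def formal_sum_def)
qed

lemma agree_upto_B_partial: "agree_upto r u v \<Longrightarrow> agree_upto r (B_partial n M x u) (B_partial n M x v)"
  by (induction n arbitrary: u v) (auto simp: agree_upto_exp_op)

lemma agree_upto_exp_op_id:
  assumes "i \<le> - int r" shows "agree_upto r (exp_op x (E_op i) v) v"
  unfolding agree_upto_def
proof (intro allI impI)
  fix m assume m: "\<forall>k. PhiStar k \<in># m \<longrightarrow> k \<le> r"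
  have "E_target i \<notin># m" using m assms by (force simp: E_target_def)
  then have z: "(E_op i ^^ n) v m = 0" if "n \<noteq> 0" for n
    using that E_op_power_eq_0[of m i n v] by (simp add: not_in_iff)
  have "exp_op x (E_op i) v m = Sum_any (\<lambda>n::nat. if n = 0 then v m else 0)"
    unfolding exp_op_def formal_sum_def by (rule arg_cong[where f = Sum_any]) (auto simp: z)
  also have "\<dots> = (\<Sum>n\<in>{0::nat}. if n = 0 then v m else 0)"
    by (rule Sum_any.expand_superset) auto
  finally show "exp_op x (E_op i) v m = v m" by simp
qed

lemma B_partial_stable:
  "\<exists>n0. \<forall>n\<ge>n0. B_partial n M x v m = B_partial n0 M x v m"
proof -
  define r where "r = Max (insert 0 ((\<lambda>g. case g of Phi k \<Rightarrow> 0 | PhiStar k \<Rightarrow> k) ` set_mset m))"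
  have r: "\<forall>k. PhiStar k \<in># m \<longrightarrow> k \<le> r"
  proof (intro allI impI)
    fix k assume "PhiStar k \<in># m"
    then have "k \<in> (\<lambda>g. case g of Phi k \<Rightarrow> 0 | PhiStar k \<Rightarrow> k) ` set_mset m"
      by (intro image_eqI[of _ _ "PhiStar k"]) auto
    then show "k \<le> r" unfolding r_def by (intro Max_ge) auto
  qed
  have "B_partial n M x v m = B_partial (M + r) M x v m" if "n \<ge> M + r" for n
    using that
  proof (induction n rule: dec_induct)
    case (step n)
    have "agree_upto r (exp_op x (E_op (int M - int n)) v) v"
      using step by (intro agree_upto_exp_op_id) linarith
    then have "agree_upto r (B_partial (Suc n) M x v) (B_partial n M x v)"
      by (simp add: agree_upto_B_partial)
    then show ?case using step r by (simp add: agree_upto_def)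
  qed simp
  then show ?thesis by blast
qed

lemma B_star_stable: "\<forall>\<^sub>F n in sequentially. B_partial n M x v m = B_star M x v m"
proof -
  obtain n0 where "\<forall>n\<ge>n0. B_partial n M x v m = B_partial n0 M x v m"
    using B_partial_stable[of M x v m] by (rule exE)
  then have ev: "\<forall>\<^sub>F n in sequentially. B_partial n M x v m = B_partial n0 M x v m"
    unfolding eventually_sequentially by (rule exI[of _ n0])
  have "B_star M x v m = B_partial n0 M x v m"
    unfolding B_star_def
  proof (rule the_equality[where P = "\<lambda>c. \<forall>\<^sub>F n in sequentially. B_partial n M x v m = c"])
    fix c assume "\<forall>\<^sub>F n in sequentially. B_partial n M x v m = c"
    with ev have "\<forall>\<^sub>F n in sequentially. c = B_partial n0 M x v m"
      by (rule eventually_elim2) (rule trans[OF sym])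
    then show "c = B_partial n0 M x v m" by simp
  qed (rule ev)
  with ev show ?thesis by (simp only:)
qed

end

theory Submission
  imports Defs
begin

text \<open>
  Write \<open>S = \<Sum>\<^sub>i \<phi>\<^sub>i \<otimes> \<phi>\<^sup>*\<^bsub>-i\<^esub>\<close> for the operator of the bosonic KP equation and
  \<open>E\<^sub>i = \<phi>\<^bsub>-i\<^esub> \<phi>\<^sup>*\<^bsub>i-1\<^esub>\<close> for the quadratic operators exponentiated in \<open>B\<^sup>*(x)\<close>. Two facts make \<open>\<tau>\<close> a
  solution: \<open>S\<close> annihilates \<open>|0\<rangle> \<otimes> |0\<rangle>\<close>, because in every summand one of the two factors is an
  annihilation operator, and \<open>S\<close> commutes with \<open>E\<^sub>i \<otimes> 1 + 1 \<otimes> E\<^sub>i\<close>, because the only nonzero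
  contributions \<open>[\<phi>\<^bsub>1-i\<^esub>, E\<^sub>i] = \<phi>\<^bsub>-i\<^esub>\<close> and \<open>[\<phi>\<^sup>*\<^sub>i, E\<^sub>i] = - \<phi>\<^sup>*\<^bsub>i-1\<^esub>\<close> enter the sum with
  opposite signs. Hence \<open>S (e \<otimes> e) = (e \<otimes> e) S\<close> for \<open>e = exp (x E\<^sub>i)\<close>, and solutions are
  preserved by each factor of \<open>B\<^sup>*(x)\<close> (\<open>bosonic_KP_exp_op\<close>).

  Nothing more is needed to deal with the formal limits than the observation that every
  coefficient is computed from finitely many others. A mode operator sends a vector to one whose
  coefficient at a monomial is a multiple of a single coefficient of the original (\<open>row_single\<close>);
  a coefficient of \<open>exp (x E\<^sub>i) v\<close> is a finite combination of coefficients of \<open>v\<close>, by local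
  nilpotency of \<open>E\<^sub>i\<close>; and a coefficient of \<open>S (u \<otimes> v)\<close> involves only a finite range of \<open>i\<close>
  which depends on the pair of monomials and not on \<open>u\<close> and \<open>v\<close> (\<open>KP_range\<close>). The last point
  lets one pass from the partial products to \<open>B\<^sup>*(x)\<close> itself: the coefficient of \<open>S\<close> at a
  given pair of monomials only sees finitely many coefficients of each factor, and on those the
  partial products have already become stationary (\<open>bosonic_KP_B_star\<close>).
\<close>

section \<open>Operators whose coefficients depend on a single coefficient\<close>

definition row_single :: "(fock \<Rightarrow> fock) \<Rightarrow> bool" where
  "row_single A \<longleftrightarrow> (\<forall>m. \<exists>c m'. \<forall>v. A v m = c * v m')"

lemma row_singleD: "row_single A \<Longrightarrow> \<exists>c m'. \<forall>v. A v m = c * v m'"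
  by (simp add: row_single_def)

lemma row_single_create: "row_single (create g)"
  unfolding row_single_def
proof
  fix m
  show "\<exists>c m'. \<forall>v. create g v m = c * v m'"
    by (rule exI[of _ "if g \<in># m then 1 else 0"], rule exI[of _ "m - {#g#}"])
      (simp add: create_def)
qed

lemma row_single_annihilate: "row_single (annihilate g)"
  unfolding row_single_def annihilate_def by blast

lemma row_single_uminus:
  assumes "row_single A" shows "row_single (\<lambda>v m. - A v m)"
  unfolding row_single_def
proof
  fix m
  obtain c m' where "\<And>v. A v m = c * v m'" using row_singleD[OF assms, of m] by blast
  then show "\<exists>c m'. \<forall>v. - A v m = c * v m'"
    by (intro exI[of _ "- c"] exI[of _ m']) simp
qed

lemma row_single_comp:
  assumes "row_single A" "row_single B" shows "row_single (A \<circ> B)"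
  unfolding row_single_def
proof
  fix m
  obtain c m' where A: "\<And>v. A v m = c * v m'" using row_singleD[OF assms(1), of m] by blast
  obtain d m'' where B: "\<And>v. B v m' = d * v m''" using row_singleD[OF assms(2), of m'] by blast
  show "\<exists>c m'. \<forall>v. (A \<circ> B) v m = c * v m'"
    by (intro exI[of _ "c * d"] exI[of _ m'']) (simp add: A B)
qed

lemma row_single_phi: "row_single (phi i)"
proof (cases "i < 0")
  case True
  then have "phi i = create (Phi (nat (- i - 1)))" by (simp add: phi_def fun_eq_iff)
  then show ?thesis by (simp add: row_single_create)
next
  case False
  then have "phi i = annihilate (PhiStar (nat i))" by (simp add: phi_def fun_eq_iff)
  then show ?thesis by (simp add: row_single_annihilate)
qed

lemma row_single_phi_star: "row_single (phi_star i)"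
proof (cases "i \<le> 0")
  case True
  then have "phi_star i = create (PhiStar (nat (- i)))" by (simp add: phi_star_def fun_eq_iff)
  then show ?thesis by (simp add: row_single_create)
next
  case False
  then have "phi_star i = (\<lambda>v m. - annihilate (Phi (nat (i - 1))) v m)"
    by (simp add: phi_star_def fun_eq_iff)
  then show ?thesis by (simp add: row_single_uminus row_single_annihilate)
qed

lemma row_single_E_op: "row_single (E_op i)"
  unfolding E_op_def by (intro row_single_comp row_single_phi row_single_phi_star)

lemma row_single_power: "row_single A \<Longrightarrow> row_single (A ^^ n)"
proof (induction n)
  case 0
  have "(A ^^ 0) v m = 1 * v m" for v m by simp
  then show ?case unfolding row_single_def by blast
next
  case (Suc n)
  then show ?case unfolding funpow.simps by (intro row_single_comp)
qed

lemma row_single_linear: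
  assumes "row_single A"
  shows "A (\<lambda>m. u m + a * v m) m = A u m + a * A v m"
proof -
  obtain c m' where "\<And>v. A v m = c * v m'" using row_singleD[OF assms, of m] by blast
  then show ?thesis by (simp add: algebra_simps)
qed

section \<open>Moving a mode past an exponential\<close>

lemma exp_op_E_eq_sum:
  assumes "count m (E_target i) < K"
  shows "exp_op x (E_op i) v m = (\<Sum>k<K. x ^ k / fact k * (E_op i ^^ k) v m)"
  unfolding exp_op_def formal_sum_def
proof (rule Sum_any.expand_superset)
  show "{k. x ^ k / fact k * (E_op i ^^ k) v m \<noteq> 0} \<subseteq> {..<K}"
  proof
    fix k assume "k \<in> {k. x ^ k / fact k * (E_op i ^^ k) v m \<noteq> 0}"
    then have "(E_op i ^^ k) v m \<noteq> 0" by simp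
    then have "\<not> count m (E_target i) < k" using E_op_power_eq_0 by blast
    then show "k \<in> {..<K}" using assms by simp
  qed
qed simp

lemma exp_op_E_row_finite:
  "\<exists>(K::nat) c p. \<forall>v. exp_op x (E_op i) v m = (\<Sum>k<K. c k * v (p k))"
proof -
  have "\<exists>d q. \<forall>v. (E_op i ^^ k) v m = d * v q" for k
    using row_single_power[OF row_single_E_op] unfolding row_single_def by blast
  then obtain d q where dq: "\<And>k v. (E_op i ^^ k) v m = d k * v (q k)" by metis
  have "exp_op x (E_op i) v m =
      (\<Sum>k<Suc (count m (E_target i)). (x ^ k / fact k * d k) * v (q k))" for v
    by (subst exp_op_E_eq_sum[of m i "Suc (count m (E_target i))"]) (simp_all add: dq mult.assoc)
  then show ?thesis
    by (intro exI[of _ "Suc (count m (E_target i))"] exI[of _ "\<lambda>k. x ^ k / fact k * d k"]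
        exI[of _ q] allI)
qed

text \<open>
  Since \<open>[D, -]\<close> is a derivation, each of the \<open>n\<close> factors of \<open>E\<^sup>n\<close> is replaced once by
  \<open>[D, E] = a F\<close>, and \<open>F\<close> can then be collected on the right.
\<close>

lemma commutator_power:
  assumes E: "row_single E"
    and DE: "\<And>v. D (E v) = (\<lambda>m. E (D v) m + a * F v m)"
    and FE: "\<And>v. F (E v) = E (F v)"
  shows "D ((E ^^ n) v) m = (E ^^ n) (D v) m + of_nat n * a * (E ^^ (n - 1)) (F v) m"
proof (induction n arbitrary: v m)
  case (Suc n)
  have F: "(E ^^ n) (F v) = F ((E ^^ n) v)" for n v
    by (induction n) (simp_all add: FE)
  have "D ((E ^^ Suc n) v) m = E (D ((E ^^ n) v)) m + a * F ((E ^^ n) v) m"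
    by (simp add: DE)
  also have "D ((E ^^ n) v) =
      (\<lambda>m. (E ^^ n) (D v) m + (of_nat n * a) * (E ^^ (n - 1)) (F v) m)"
    by (rule ext) (rule Suc)
  also have "E \<dots> m = (E ^^ Suc n) (D v) m + of_nat n * a * E ((E ^^ (n - 1)) (F v)) m"
    by (simp add: row_single_linear[OF E])
  also have "of_nat n * a * E ((E ^^ (n - 1)) (F v)) m = of_nat n * a * (E ^^ n) (F v) m"
    by (cases n) simp_all
  finally show ?case by (simp add: F algebra_simps)
qed simp

text \<open>
  The integrated form \<open>D e = e D + x a e F\<close> with \<open>e = exp (x E\<^sub>i)\<close>; all three exponentials may be cut
  off at a common order, so this is an identity of finite sums.
\<close>

lemma commutator_exp_op:
  assumes D: "row_single D"
    and DE: "\<And>v. D (E_op i v) = (\<lambda>m. E_op i (D v) m + a * F v m)"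
    and FE: "\<And>v. F (E_op i v) = E_op i (F v)"
  shows "D (exp_op x (E_op i) v) m =
    exp_op x (E_op i) (D v) m + x * a * exp_op x (E_op i) (F v) m"
proof -
  let ?E = "E_op i"
  obtain c m' where c: "\<And>v. D v m = c * v m'" using row_singleD[OF D, of m] by blast
  define K where "K = Suc (max (count m (E_target i)) (count m' (E_target i)))"
  have K: "count m (E_target i) < K" "count m' (E_target i) < K" by (simp_all add: K_def)
  have "D (exp_op x ?E v) m = (\<Sum>k<Suc K. x ^ k / fact k * D ((?E ^^ k) v) m)"
    unfolding c exp_op_E_eq_sum[OF less_SucI[OF K(2)]] sum_distrib_left
    by (intro sum.cong refl mult.left_commute)
  also have "\<dots> = (\<Sum>k<Suc K. x ^ k / fact k * (?E ^^ k) (D v) m) +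
      (\<Sum>k<Suc K. x ^ k / fact k * (of_nat k * a * (?E ^^ (k - 1)) (F v) m))"
    unfolding sum.distrib[symmetric]
    by (intro sum.cong refl)
      (simp only: commutator_power[where E = ?E and D = D and a = a and F = F, OF row_single_E_op DE FE] distrib_left)
  also have "(\<Sum>k<Suc K. x ^ k / fact k * (?E ^^ k) (D v) m) = exp_op x ?E (D v) m"
    using K by (intro exp_op_E_eq_sum[symmetric]) simp
  also have "(\<Sum>k<Suc K. x ^ k / fact k * (of_nat k * a * (?E ^^ (k - 1)) (F v) m)) =
      (\<Sum>k<K. x ^ Suc k / fact (Suc k) * (of_nat (Suc k) * a * (?E ^^ k) (F v) m))"
    unfolding sum.lessThan_Suc_shift by simp
  also have "\<dots> = (\<Sum>k<K. x * a * (x ^ k / fact k * (?E ^^ k) (F v) m))"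
  proof (intro sum.cong refl)
    fix k
    have "of_nat (Suc k) / fact (Suc k) = (1 / fact k :: complex)"
      by (simp add: divide_simps del: of_nat_Suc)
    then have "x ^ Suc k * a * (?E ^^ k) (F v) m * (of_nat (Suc k) / fact (Suc k)) =
        x ^ Suc k * a * (?E ^^ k) (F v) m * (1 / fact k)" by simp
    then show "x ^ Suc k / fact (Suc k) * (of_nat (Suc k) * a * (?E ^^ k) (F v) m) =
        x * a * (x ^ k / fact k * (?E ^^ k) (F v) m)"
      by (simp add: mult_ac del: of_nat_Suc fact_Suc)
  qed
  also have "\<dots> = x * a * exp_op x ?E (F v) m"
    unfolding sum_distrib_left[symmetric] exp_op_E_eq_sum[OF K(1)] ..
  finally show ?thesis .
qed

lemma phi_E_op:
  "phi j (E_op i v) = (\<lambda>m. E_op i (phi j v) m + (if j = 1 - i then 1 else 0) * phi (- i) v m)"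
proof
  fix m
  have "phi j (phi_star (i - 1) v) =
      (\<lambda>m. phi_star (i - 1) (phi j v) m + (if j = 1 - i then 1 else 0) * v m)"
    using phi_phi_star_commutator[of j "i - 1" v] by (auto simp: fun_eq_iff diff_eq_eq)
  then show "phi j (E_op i v) m =
      E_op i (phi j v) m + (if j = 1 - i then 1 else 0) * phi (- i) v m"
    by (simp only: E_op_def o_apply phi_phi_commute[of j "- i"]
        row_single_linear[OF row_single_phi])
qed

lemma phi_star_E_op:
  "phi_star j (E_op i v) =
    (\<lambda>m. E_op i (phi_star j v) m + (if j = i then - 1 else 0) * phi_star (i - 1) v m)"
proof
  fix m
  show "phi_star j (E_op i v) m =
      E_op i (phi_star j v) m + (if j = i then - 1 else 0) * phi_star (i - 1) v m"
    using phi_phi_star_commutator[of "- i" j "phi_star (i - 1) v" m]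
    by (auto simp: E_op_def phi_star_phi_star_commute[of j "i - 1"] algebra_simps split: if_splits)
qed

lemma phi_exp_op:
  "phi j (exp_op x (E_op i) v) m = exp_op x (E_op i) (phi j v) m +
    (if j = 1 - i then x * exp_op x (E_op i) (phi (- i) v) m else 0)"
proof -
  have "phi (- i) (E_op i w) = E_op i (phi (- i) w)" for w
    by (simp add: phi_E_op)
  from commutator_exp_op[where F = "phi (- i)", OF row_single_phi phi_E_op this]
  show ?thesis by simp
qed

lemma phi_star_exp_op:
  "phi_star j (exp_op x (E_op i) v) m = exp_op x (E_op i) (phi_star j v) m -
    (if j = i then x * exp_op x (E_op i) (phi_star (i - 1) v) m else 0)"
proof -
  have "phi_star (i - 1) (E_op i w) = E_op i (phi_star (i - 1) w)" for w
    by (simp add: phi_star_E_op)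
  from commutator_exp_op[where F = "phi_star (i - 1)", OF row_single_phi_star phi_star_E_op this]
  show ?thesis by simp
qed

section \<open>The bosonic KP equation is preserved\<close>

definition bosonic_KP :: "fock \<Rightarrow> fock \<Rightarrow> bool" where
  "bosonic_KP u v \<longleftrightarrow> formal_sum (\<lambda>i::int. tensor (phi i u) (phi_star (- i) v)) = (\<lambda>_. 0)"

text \<open>
  For \<open>i < 0\<close> the creation operator \<open>\<phi>\<^sub>i\<close> can only reach a left monomial containing its mode, and for
  \<open>i \<ge> 0\<close> the same holds for \<open>\<phi>\<^sup>*\<^bsub>-i\<^esub>\<close> on the right; this bounds the summation index in terms of the
  monomials alone.
\<close>

definition KP_range :: "mode multiset \<Rightarrow> mode multiset \<Rightarrow> int set" where
  "KP_range m n = {i. if i < 0 then Phi (nat (- i - 1)) \<in># m else PhiStar (nat i) \<in># n}"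

lemma finite_KP_range: "finite (KP_range m n)"
proof (rule finite_subset)
  show "KP_range m n \<subseteq>
     (\<lambda>g. case g of Phi k \<Rightarrow> - int k - 1 | PhiStar k \<Rightarrow> int k) ` (set_mset m \<union> set_mset n)"
  proof
    fix i assume i: "i \<in> KP_range m n"
    show "i \<in> (\<lambda>g. case g of Phi k \<Rightarrow> - int k - 1 | PhiStar k \<Rightarrow> int k) ` (set_mset m \<union> set_mset n)"
    proof (cases "i < 0")
      case True
      then show ?thesis using i
        by (intro image_eqI[of _ _ "Phi (nat (- i - 1))"]) (auto simp: KP_range_def)
    next
      case False
      then show ?thesis using i
        by (intro image_eqI[of _ _ "PhiStar (nat i)"]) (auto simp: KP_range_def)
    qed
  qed
qed simp

lemma KP_coefficient:
  assumes "finite J" "KP_range m n \<subseteq> J"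
  shows "formal_sum (\<lambda>i::int. tensor (phi i u) (phi_star (- i) v)) (m, n) =
    (\<Sum>i\<in>J. phi i u m * phi_star (- i) v n)"
proof -
  have "{i. phi i u m * phi_star (- i) v n \<noteq> 0} \<subseteq> J"
  proof
    fix i assume "i \<in> {i. phi i u m * phi_star (- i) v n \<noteq> 0}"
    then have "i \<in> KP_range m n"
      by (auto simp: KP_range_def phi_def phi_star_def create_def split: if_splits)
    then show "i \<in> J" using assms(2) by blast
  qed
  then show ?thesis
    unfolding formal_sum_def tensor_def prod.case using assms(1)
    by (intro Sum_any.expand_superset)
qed

lemma bosonic_KP_iff:
  "bosonic_KP u v \<longleftrightarrow> (\<forall>m n. (\<Sum>i\<in>KP_range m n. phi i u m * phi_star (- i) v n) = 0)"
  unfolding bosonic_KP_def fun_eq_iff split_paired_All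
  by (simp add: KP_coefficient[OF finite_KP_range subset_refl])

lemma bosonic_KP_sum_eq_0:
  assumes "bosonic_KP u v" "finite J" "KP_range m n \<subseteq> J"
  shows "(\<Sum>i\<in>J. phi i u m * phi_star (- i) v n) = 0"
  using KP_coefficient[OF assms(2,3), of u v] assms(1) by (simp add: bosonic_KP_def)

text \<open>
  This is \<open>S (e \<otimes> e) = (e \<otimes> e) S\<close> for \<open>e = exp (x E\<^sub>i)\<close>, read off at one pair of monomials: there
  \<open>e \<otimes> e\<close> is a finite combination of coefficients of \<open>S (u \<otimes> v)\<close>, all of which vanish. The index
  set \<open>J\<close> is chosen large enough for all of these coefficients at once, so that every interchange
  of sums is between finite sums.
\<close>

lemma bosonic_KP_exp_op:
  assumes uv: "bosonic_KP u v"
  shows "bosonic_KP (exp_op x (E_op i) u) (exp_op x (E_op i) v)"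
  unfolding bosonic_KP_def fun_eq_iff
proof
  fix b :: "mode multiset \<times> mode multiset"
  obtain m n where b: "b = (m, n)" by (cases b)
  let ?e = "exp_op x (E_op i)"
  obtain K c p where e_m: "\<And>w. ?e w m = (\<Sum>k<(K::nat). c k * w (p k))"
    using exp_op_E_row_finite[of x i m] by blast
  obtain L d q where e_n: "\<And>w. ?e w n = (\<Sum>l<(L::nat). d l * w (q l))"
    using exp_op_E_row_finite[of x i n] by blast
  define J where "J = KP_range m n \<union> (\<Union>k<K. \<Union>l<L. KP_range (p k) (q l)) \<union> {- i, 1 - i}"
  have J: "finite J" "- i \<in> J" "1 - i \<in> J" "KP_range m n \<subseteq> J"
    by (auto simp: J_def finite_KP_range)
  define A where "A j = ?e (phi j u) m" for j
  define B where "B j = ?e (phi_star (- j) v) n" for j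
  have "(\<Sum>j\<in>J. phi j (?e u) m * phi_star (- j) (?e v) n) =
      (\<Sum>j\<in>J. (A j + (if j = 1 - i then x * A (- i) else 0)) *
               (B j - (if j = - i then x * B (1 - i) else 0)))"
    by (intro sum.cong refl) (auto simp: phi_exp_op phi_star_exp_op A_def B_def)
  also have "\<dots> = (\<Sum>j\<in>J. A j * B j + (if j = 1 - i then x * A (- i) * B (1 - i) else 0)
        - (if j = - i then x * A (- i) * B (1 - i) else 0))"
  proof (intro sum.cong refl)
    fix j
    show "(A j + (if j = 1 - i then x * A (- i) else 0)) *
          (B j - (if j = - i then x * B (1 - i) else 0)) =
        A j * B j + (if j = 1 - i then x * A (- i) * B (1 - i) else 0)
        - (if j = - i then x * A (- i) * B (1 - i) else 0)"
      by (cases "j = 1 - i"; cases "j = - i") (simp_all add: distrib_right right_diff_distrib)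
  qed
  \<comment> \<open>The two correction terms are \<open>\<plusminus> x e \<phi>\<^bsub>-i\<^esub> u \<otimes> e \<phi>\<^sup>*\<^bsub>i-1\<^esub> v\<close>, sitting at indices \<open>1 - i\<close> and \<open>-i\<close>.\<close>
  also have "\<dots> = (\<Sum>j\<in>J. A j * B j)"
    using J by (simp add: sum.distrib sum_subtractf)
  also have "\<dots> = (\<Sum>j\<in>J. \<Sum>k<K. \<Sum>l<L. c k * d l * (phi j u (p k) * phi_star (- j) v (q l)))"
    by (simp add: A_def B_def e_m e_n sum_product mult_ac)
  also have "\<dots> = (\<Sum>k<K. \<Sum>j\<in>J. \<Sum>l<L. c k * d l * (phi j u (p k) * phi_star (- j) v (q l)))"
    by (rule sum.swap)
  also have "\<dots> = (\<Sum>k<K. \<Sum>l<L. c k * d l * (\<Sum>j\<in>J. phi j u (p k) * phi_star (- j) v (q l)))"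
    unfolding sum_distrib_left by (intro sum.cong refl sum.swap)
  also have "\<dots> = 0"
  proof (intro sum.neutral ballI)
    fix k l assume "k \<in> {..<K}" "l \<in> {..<L}"
    then have "KP_range (p k) (q l) \<subseteq> J" by (auto simp: J_def)
    then show "c k * d l * (\<Sum>j\<in>J. phi j u (p k) * phi_star (- j) v (q l)) = 0"
      using bosonic_KP_sum_eq_0[OF uv J(1)] by simp
  qed
  finally show "formal_sum (\<lambda>j::int. tensor (phi j (?e u)) (phi_star (- j) (?e v))) b = 0"
    by (simp add: b KP_coefficient[OF J(1) J(4)])
qed

lemma bosonic_KP_B_partial:
  "bosonic_KP u v \<Longrightarrow> bosonic_KP (B_partial n M x u) (B_partial n M x v)"
  by (induction n arbitrary: u v) (auto intro: bosonic_KP_exp_op)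

lemma eventually_row_single_B_star:
  assumes "row_single A"
  shows "\<forall>\<^sub>F n in sequentially. A (B_partial n M x v) m = A (B_star M x v) m"
proof -
  obtain c m' where "\<And>w. A w m = c * w m'" using row_singleD[OF assms, of m] by blast
  then show ?thesis using B_star_stable[of M x v m'] by (auto elim: eventually_mono)
qed

text \<open>
  Only finitely many single coefficients of the two vectors enter a given coefficient of the
  equation, so one partial product of sufficiently high order computes all of them correctly.
\<close>

lemma bosonic_KP_B_star:
  assumes "bosonic_KP u v"
  shows "bosonic_KP (B_star M x u) (B_star M x v)"
  unfolding bosonic_KP_iff
proof (intro allI)
  fix m n
  let ?R = "KP_range m n"
  have "\<forall>\<^sub>F r in sequentially. \<forall>i\<in>?R.
      phi i (B_partial r M x u) m = phi i (B_star M x u) m \<and>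
      phi_star (- i) (B_partial r M x v) n = phi_star (- i) (B_star M x v) n"
    by (intro eventually_ball_finite finite_KP_range ballI eventually_conj
        eventually_row_single_B_star row_single_phi row_single_phi_star)
  then obtain r where r: "\<And>i. i \<in> ?R \<Longrightarrow>
      phi i (B_partial r M x u) m = phi i (B_star M x u) m \<and>
      phi_star (- i) (B_partial r M x v) n = phi_star (- i) (B_star M x v) n"
    by (auto simp: eventually_sequentially)
  have "(\<Sum>i\<in>?R. phi i (B_star M x u) m * phi_star (- i) (B_star M x v) n) =
      (\<Sum>i\<in>?R. phi i (B_partial r M x u) m * phi_star (- i) (B_partial r M x v) n)"
    using r by (intro sum.cong) auto
  also have "\<dots> = 0"
    using bosonic_KP_B_partial[OF assms] by (simp add: bosonic_KP_iff)
  finally show "(\<Sum>i\<in>?R. phi i (B_star M x u) m * phi_star (- i) (B_star M x v) n) = 0" .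
qed

lemma bosonic_KP_vacuum: "bosonic_KP vacuum vacuum"
proof -
  have "phi i vacuum m * phi_star (- i) vacuum n = 0" for i m n
    using phi_vacuum[of i] phi_star_vacuum[of "- i - 1"] by (cases "i \<ge> 0") simp_all
  then show ?thesis unfolding bosonic_KP_iff by (intro allI sum.neutral ballI)
qed

lemma bosonic_KP_B_star_product:
  "bosonic_KP (foldr (\<lambda>j. B_star M (x j)) js vacuum) (foldr (\<lambda>j. B_star M (x j)) js vacuum)"
  by (induction js) (simp_all add: bosonic_KP_vacuum bosonic_KP_B_star)

text \<open>
  The powers \<open>z\<^bsup>-i-1\<^esup>\<close> and \<open>z\<^sup>i\<close> multiply to \<open>z\<^bsup>-1\<^esup>\<close>, so the substitution is \<open>k = - i - 1\<close>.
\<close>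

lemma Res_tensor_field:
  "Res (tensor_field (phi_field u) (phi_star_field v)) =
    formal_sum (\<lambda>i::int. tensor (phi i u) (phi_star (- i) v))"
proof
  fix b
  have "bij (\<lambda>i::int. - i - 1)"
    by (rule bij_betw_byWitness[where f' = "\<lambda>i. - i - 1"]) auto
  then have "Sum_any (\<lambda>k. tensor (phi (- k - 1) u) (phi_star (k + 1) v) b) =
      Sum_any (\<lambda>i. tensor (phi i u) (phi_star (- i) v) b)"
    by (rule Sum_any.reindex_cong[symmetric]) (simp add: fun_eq_iff add.commute)
  then show "Res (tensor_field (phi_field u) (phi_star_field v)) b =
      formal_sum (\<lambda>i::int. tensor (phi i u) (phi_star (- i) v)) b"
    by (simp add: Res_def tensor_field_def phi_field_def phi_star_field_def formal_sum_def
        add.commute)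
qed

theorem mainTheorem12:
  fixes M N :: nat and x :: "nat \<Rightarrow> complex" and tau :: fock
  assumes "M \<ge> 1" and "N \<ge> 1"
    and tau: "tau = foldr (\<lambda>j. B_star M (x j)) [1..<Suc N] vacuum"
  shows "locally_finite (\<lambda>i::int. tensor (phi i tau) (phi_star (- i) tau)) \<and>
    Res (tensor_field (phi_field tau) (phi_star_field tau))
      = formal_sum (\<lambda>i::int. tensor (phi i tau) (phi_star (- i) tau)) \<and>
    formal_sum (\<lambda>i::int. tensor (phi i tau) (phi_star (- i) tau)) = (\<lambda>_. 0)"
  using bosonic_KP_B_star_product[of M x "[1..<Suc N]"]
  unfolding tau[symmetric] bosonic_KP_def
  by (intro conjI locally_finite_KP Res_tensor_field)

end
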